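(* For every formula $\varphi$ and agent $a\in\mathcal A$, the formula $\neg\neg B_a\neg\neg\varphi\to\neg\neg B_a\varphi$ is true in every EGL-model $M=(S,(r_a)_{a\in\mathcal A},\pi)$ in which $S$ is finite.
   Context: Fix a set $\mathcal P$ of atomic propositions and a set $\mathcal A$ of agents. Formulas: $\varphi ::= p \mid \bot \mid \varphi\wedge\varphi \mid \varphi\to\varphi \mid B_a\varphi$ with $p\in\mathcal P$, $a\in\mathcal A$; $\neg\varphi=\varphi\to\bot$. An EGL-model is $M=(S,(r_a)_{a\in\mathcal A},\pi)$ where $S$ is a non-empty countable set, each $r_a:S\times S\to[0,1]$, and $\pi:S\times\mathcal P\to[0,1]$. Values: $V_s(p)=\pi(s,p)$; $V_s(\bot)=0$; $V_s(\varphi\wedge\psi)=\min\{V_s(\varphi),V_s(\psi)\}$; $V_s(\varphi\to\psi)=1$ if $V_s(\varphi)\le V_s(\psi)$ and $=V_s(\psi)$ otherwise; $V_s(B_a\varphi)=\inf_{s'\in S}\max\{1-r_a(s,s'),V_{s'}(\varphi)\}$. $\varphi$ is true in $M$ if $V_s(\varphi)=1$ for all $s\in S$. *)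

theory Defs
  imports "HOL-Library.Countable_Set" Complex_Main
begin

text \<open>
  The sets of atomic propositions and of agents are the types \<open>'p\<close> and \<open>'a\<close>.
\<close>

datatype ('p, 'a) fml =
    Atom 'p
  | Falsum
  | Conj "('p, 'a) fml" "('p, 'a) fml"
  | Impl "('p, 'a) fml" "('p, 'a) fml"
  | Bel 'a "('p, 'a) fml"

definition Neg :: "('p, 'a) fml \<Rightarrow> ('p, 'a) fml" where
  "Neg \<phi> = Impl \<phi> Falsum"

record ('s, 'p, 'a) egl =
  states :: "'s set"
  acc :: "'a \<Rightarrow> 's \<Rightarrow> 's \<Rightarrow> real"
  valuation :: "'s \<Rightarrow> 'p \<Rightarrow> real"

text \<open>
  \<open>acc\<close> and \<open>valuation\<close> are total functions; only their restrictions to the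
  set of states are constrained, and only these matter below.
\<close>

definition egl_model :: "('s, 'p, 'a) egl \<Rightarrow> bool" where
  "egl_model M \<longleftrightarrow>
     states M \<noteq> {} \<and> countable (states M) \<and>
     (\<forall>a. \<forall>s\<in>states M. \<forall>s'\<in>states M. acc M a s s' \<in> {0..1}) \<and>
     (\<forall>s\<in>states M. \<forall>p. valuation M s p \<in> {0..1})"

text \<open>
  In an EGL-model the infimum below is over a non-empty set of reals bounded below, so
  it is the genuine one (see \<open>val_in_unit\<close>).
\<close>

primrec val :: "('s, 'p, 'a) egl \<Rightarrow> ('p, 'a) fml \<Rightarrow> 's \<Rightarrow> real" where
  "val M (Atom p) s = valuation M s p"
| "val M Falsum s = 0"
| "val M (Conj \<phi> \<psi>) s = min (val M \<phi> s) (val M \<psi> s)"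
| "val M (Impl \<phi> \<psi>) s = (if val M \<phi> s \<le> val M \<psi> s then 1 else val M \<psi> s)"
| "val M (Bel a \<phi>) s = (INF s'\<in>states M. max (1 - acc M a s s') (val M \<phi> s'))"

definition true_in :: "('s, 'p, 'a) egl \<Rightarrow> ('p, 'a) fml \<Rightarrow> bool" where
  "true_in M \<phi> \<longleftrightarrow> (\<forall>s\<in>states M. val M \<phi> s = 1)"

lemma val_in_unit:
  assumes M: "egl_model M" and s: "s \<in> states M"
  shows "val M \<phi> s \<in> {0..1}"
  using s
proof (induction \<phi> arbitrary: s)
  case (Bel a \<phi>)
  let ?f = "\<lambda>s'. max (1 - acc M a s s') (val M \<phi> s')"
  have b: "0 \<le> ?f s' \<and> ?f s' \<le> 1" if "s' \<in> states M" for s'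
    using Bel that M by (auto simp: egl_model_def max_def)
  have "bdd_below (?f ` states M)"
    by (rule bdd_belowI[of _ 0]) (use b in blast)
  then have "Inf (?f ` states M) \<le> 1"
    using b Bel.prems by (meson cINF_lower2)
  moreover have "0 \<le> Inf (?f ` states M)"
    using M b by (intro cINF_greatest) (auto simp: egl_model_def)
  ultimately show ?case by simp
qed (use M in \<open>auto simp: egl_model_def min_def\<close>)

end

(* The value of a double negation is 1 or 0 according to whether the value of the formula is
   positive or not, so only positivity of values matters.  When S is finite the infimum defining
   B_a is a minimum; it is positive iff all its terms are, and the positivity of a term
   max (1 - r_a(s,s')) (V_{s'}(phi)) is unaffected by replacing phi with its double negation. *)
theory Submission
  imports Defs
begin

lemma val_Neg_Neg: "val M (Neg (Neg \<phi>)) s = (if val M \<phi> s > 0 then 1 else 0)"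
  by (simp add: Neg_def)

text \<open>Finiteness enters here: the infimum of finitely many positive terms is positive, while
  infinitely many could approach 0. A maximum is positive iff one of its arguments is.\<close>

lemma val_Bel_pos_iff:
  assumes "finite (states M)" and "states M \<noteq> {}"
  shows "val M (Bel a \<phi>) s > 0 \<longleftrightarrow> (\<forall>s'\<in>states M. acc M a s s' < 1 \<or> val M \<phi> s' > 0)"
  using assms by (auto simp: finite_less_Inf_iff less_max_iff_disj)

theorem proposition5p1:
  fixes M :: "('s, 'p, 'a) egl" and \<phi> :: "('p, 'a) fml" and a :: 'a
  assumes "egl_model M" and "finite (states M)"
  shows "true_in M (Impl (Neg (Neg (Bel a (Neg (Neg \<phi>))))) (Neg (Neg (Bel a \<phi>))))"
proof -
  have ne: "states M \<noteq> {}"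
    using assms(1) by (simp add: egl_model_def)
  have "val M (Bel a (Neg (Neg \<phi>))) s > 0 \<longleftrightarrow> val M (Bel a \<phi>) s > 0" for s
    unfolding val_Bel_pos_iff[OF assms(2) ne] by (auto simp: val_Neg_Neg)
  then show ?thesis
    \<comment> \<open>Both sides of the implication take the same value, 0 or 1. Removing
      \<open>val.simps(5)\<close> keeps the values of \<open>Bel\<close> formulas folded, as only
      the equivalence of their positivity matters.\<close>
    by (simp add: true_in_def val_Neg_Neg del: val.simps(5))
qed

end
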